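(* Let $m\ge 2$ be an integer and $q\in(0,1]$. In the limit $n\to\infty$ of infinitely many raters, the Polarizing-Averaging Aggregator $f^{PAA}$ is optimal. That is, for every aggregator $f:\Delta_m\to\mathbb{R}$, $$\sup_{\boldsymbol p\in\Delta_m,\ \boldsymbol g\in[q,1]^m}\Bigl(f^{PAA}(\hat{\boldsymbol p})-\sum_{r=1}^m r\,p_r\Bigr)^2\ \le\ \sup_{\boldsymbol p\in\Delta_m,\ \boldsymbol g\in[q,1]^m}\Bigl(f(\hat{\boldsymbol p})-\sum_{r=1}^m r\,p_r\Bigr)^2,$$ where $\hat{\boldsymbol p}=\hat{\boldsymbol p}(\boldsymbol p,\boldsymbol g)$ is the distribution of observed ratings, $\hat p_r=\dfrac{p_rg_r}{\sum_{j=1}^m p_jg_j}$ for $r=1,\dots,m$.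
   Context: $\Delta_m$ denotes the set of probability vectors $\boldsymbol p=(p_1,\dots,p_m)$ on the ratings $\{1,\dots,m\}$. Each rater has a true rating drawn independently from $\boldsymbol p$; a rater whose rating is $r$ reports it with probability $g_r\in[q,1]$ and otherwise the rating is unobserved. The parameter $q$ is known, $\boldsymbol p$ and $\boldsymbol g$ are not. The goal is to estimate the true mean $\sum_r r p_r$. When $n\to\infty$, the empirical distribution of observed ratings becomes $\hat{\boldsymbol p}\propto(p_1g_1,\dots,p_mg_m)$, the ideal aggregator that sees all ratings has zero loss, and the regret of an aggregator $f$ (a function of $\hat{\boldsymbol p}$) at $(\boldsymbol p,\boldsymbol g)$ is $(f(\hat{\boldsymbol p})-\sum_r r p_r)^2$. An aggregator is optimal if it minimizes the worst-case regret over all $(\boldsymbol p,\boldsymbol g)$. The Polarizing-Averaging Aggregator (PAA) is $f^{PAA}(\hat{\boldsymbol p})=\frac{u(\hat{\boldsymbol p})+l(\hat{\boldsymbol p})}{2}$, where $$l(\hat{\boldsymbol p})=\frac{\sum_{r=1}^{k_1}r\hat p_r+q\sum_{r=k_1+1}^{m}r\hat p_r}{\sum_{r=1}^{k_1}\hat p_r+q\sum_{r=k_1+1}^{m}\hat p_r},\qquad u(\hat{\boldsymbol p})=\frac{q\sum_{r=1}^{k_2}r\hat p_r+\sum_{r=k_2+1}^{m}r\hat p_r}{q\sum_{r=1}^{k_2}\hat p_r+\sum_{r=k_2+1}^{m}\hat p_r},$$ $k_1=k_1(\hat{\boldsymbol p})$ is the largest $k\in\{1,\dots,m\}$ such that $\sum_{r=1}^{k-1}(r-k)\hat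 p_r+q\sum_{r=k+1}^{m}(r-k)\hat p_r\ge 0$, and $k_2=k_2(\hat{\boldsymbol p})$ is the largest $k\in\{1,\dots,m\}$ such that $q\sum_{r=1}^{k-1}(r-k)\hat p_r+\sum_{r=k+1}^{m}(r-k)\hat p_r\ge 0$. *)

theory Defs
  imports "HOL-Library.Extended_Real" "HOL-Library.FuncSet"
begin

text \<open>
  Vectors indexed by the ratings \<open>1, \<dots>, m\<close> are functions on \<^typ>\<open>nat\<close>.  Members of the
  simplex vanish outside \<open>{1..m}\<close>, so that they correspond one-to-one to the probability vectors
  \<open>(p\<^sub>1, \<dots>, p\<^sub>m)\<close> and an aggregator, a function \<open>(nat \<Rightarrow> real) \<Rightarrow> real\<close> of which only the
  values on the simplex matter, cannot see anything but these \<open>m\<close> entries.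
\<close>

definition prob_simplex :: "nat \<Rightarrow> (nat \<Rightarrow> real) set" where
  "prob_simplex m =
     {p. (\<forall>r\<in>{1..m}. 0 \<le> p r) \<and> (\<forall>r. r \<notin> {1..m} \<longrightarrow> p r = 0) \<and> (\<Sum>r=1..m. p r) = 1}"

definition report_probs :: "nat \<Rightarrow> real \<Rightarrow> (nat \<Rightarrow> real) set" where
  "report_probs m q = {1..m} \<rightarrow>\<^sub>E {q..1}"

definition mean_rating :: "nat \<Rightarrow> (nat \<Rightarrow> real) \<Rightarrow> real" where
  "mean_rating m p = (\<Sum>r=1..m. real r * p r)"

definition observed :: "nat \<Rightarrow> (nat \<Rightarrow> real) \<Rightarrow> (nat \<Rightarrow> real) \<Rightarrow> nat \<Rightarrow> real" where
  "observed m p g = (\<lambda>r. p r * g r / (\<Sum>j=1..m. p j * g j))"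

definition regret ::
    "nat \<Rightarrow> ((nat \<Rightarrow> real) \<Rightarrow> real) \<Rightarrow> (nat \<Rightarrow> real) \<Rightarrow> (nat \<Rightarrow> real) \<Rightarrow> real" where
  "regret m f p g = (f (observed m p g) - mean_rating m p)\<^sup>2"

text \<open>Extended reals, because an arbitrary aggregator may have unbounded regret.\<close>

definition worst_case_regret :: "nat \<Rightarrow> real \<Rightarrow> ((nat \<Rightarrow> real) \<Rightarrow> real) \<Rightarrow> ereal" where
  "worst_case_regret m q f =
     (SUP (p, g) \<in> prob_simplex m \<times> report_probs m q. ereal (regret m f p g))"

text \<open>
  On the simplex and for \<open>0 \<le> q\<close>, \<open>m \<ge> 1\<close>, the sets in the next two definitions contain \<open>k = 1\<close>, so
  the maxima are taken over nonempty finite sets.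
\<close>

definition k1 :: "nat \<Rightarrow> real \<Rightarrow> (nat \<Rightarrow> real) \<Rightarrow> nat" where
  "k1 m q x = Max {k \<in> {1..m}.
     (\<Sum>r\<in>{1..<k}. (real r - real k) * x r) + q * (\<Sum>r\<in>{k<..m}. (real r - real k) * x r) \<ge> 0}"

definition k2 :: "nat \<Rightarrow> real \<Rightarrow> (nat \<Rightarrow> real) \<Rightarrow> nat" where
  "k2 m q x = Max {k \<in> {1..m}.
     q * (\<Sum>r\<in>{1..<k}. (real r - real k) * x r) + (\<Sum>r\<in>{k<..m}. (real r - real k) * x r) \<ge> 0}"

definition lower_est :: "nat \<Rightarrow> real \<Rightarrow> (nat \<Rightarrow> real) \<Rightarrow> real" where
  "lower_est m q x = (let k = k1 m q x in
     ((\<Sum>r\<in>{1..k}. real r * x r) + q * (\<Sum>r\<in>{k<..m}. real r * x r)) /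
     ((\<Sum>r\<in>{1..k}. x r) + q * (\<Sum>r\<in>{k<..m}. x r)))"

definition upper_est :: "nat \<Rightarrow> real \<Rightarrow> (nat \<Rightarrow> real) \<Rightarrow> real" where
  "upper_est m q x = (let k = k2 m q x in
     (q * (\<Sum>r\<in>{1..k}. real r * x r) + (\<Sum>r\<in>{k<..m}. real r * x r)) /
     (q * (\<Sum>r\<in>{1..k}. x r) + (\<Sum>r\<in>{k<..m}. x r)))"

definition PAA :: "nat \<Rightarrow> real \<Rightarrow> (nat \<Rightarrow> real) \<Rightarrow> real" where
  "PAA m q x = (upper_est m q x + lower_est m q x) / 2"

lemma observed_in_prob_simplex:
  assumes "0 < q" and p: "p \<in> prob_simplex m" and g: "g \<in> report_probs m q"
  shows "observed m p g \<in> prob_simplex m"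
proof -
  have p0: "0 \<le> p r" and g0: "q \<le> g r" if "r \<in> {1..m}" for r
    using p g that by (auto simp: prob_simplex_def report_probs_def PiE_def Pi_def)
  have "q = (\<Sum>r=1..m. p r * q)"
    using p by (simp add: prob_simplex_def flip: sum_distrib_right)
  also have "\<dots> \<le> (\<Sum>r=1..m. p r * g r)"
    using p0 g0 by (intro sum_mono mult_left_mono) auto
  finally have S: "0 < (\<Sum>r=1..m. p r * g r)"
    using \<open>0 < q\<close> by simp
  have "0 \<le> observed m p g r" if "r \<in> {1..m}" for r
    using p0[OF that] g0[OF that] \<open>0 < q\<close> S by (simp add: observed_def)
  moreover have "observed m p g r = 0" if "r \<notin> {1..m}" for r
    using p that by (simp add: prob_simplex_def observed_def)
  moreover have "(\<Sum>r=1..m. observed m p g r) = 1"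
    using S by (simp add: observed_def flip: sum_divide_distrib)
  ultimately show ?thesis
    unfolding prob_simplex_def by blast
qed

end

theory Submission
  imports Defs
begin

text \<open>
  The pairs \<open>(p, g)\<close> whose observed distribution is \<open>x\<close> are those with \<open>p r\<close> proportional to
  \<open>w r * x r\<close>, where \<open>w r = q / g r\<close> is an arbitrary weight in \<open>[q, 1]\<close>. So the possible true means
  are the reweighted means of \<open>x\<close>. Such a mean \<open>M\<close> is least when the ratings below \<open>M\<close> have weight
  \<open>1\<close> and those above have weight \<open>q\<close>, and greatest in the opposite case; the conditions defining
  \<open>k1\<close> and \<open>k2\<close> locate these two extremal means between \<open>k\<close> and \<open>k + 1\<close>. The midpoint of the
  extremal means is at distance at most half their gap from every possible mean, while any
  other estimate is at least that far from one of the two.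
\<close>

section \<open>Reweighted means and their comparison\<close>

definition weighted_mean :: "nat \<Rightarrow> (nat \<Rightarrow> real) \<Rightarrow> (nat \<Rightarrow> real) \<Rightarrow> real" where
  "weighted_mean m w x = (\<Sum>r=1..m. real r * (w r * x r)) / (\<Sum>r=1..m. w r * x r)"

text \<open>The shape of both extremal weights: \<open>1, q\<close> with cutoff \<open>k1\<close>
  for the least mean, \<open>q, 1\<close> with cutoff \<open>k2\<close> for the greatest. Arbitrary
  \<open>a, b\<close> let one threshold argument serve both.\<close>

definition split_weight :: "nat \<Rightarrow> real \<Rightarrow> real \<Rightarrow> nat \<Rightarrow> real" where
  "split_weight k a b r = (if r \<le> k then a else b)"

lemma sum_split_weight:
  assumes "k \<le> m"
  shows "(\<Sum>r=1..m. split_weight k a b r * h r) = a * (\<Sum>r\<in>{1..k}. h r) + b * (\<Sum>r\<in>{k<..m}. h r)"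
proof -
  have "{1..m} = {1..k} \<union> {k<..m}"
    using assms by auto
  then have "(\<Sum>r=1..m. split_weight k a b r * h r) =
      (\<Sum>r\<in>{1..k}. split_weight k a b r * h r) + (\<Sum>r\<in>{k<..m}. split_weight k a b r * h r)"
    by (simp add: sum.union_disjoint disjoint_iff)
  then show ?thesis
    by (simp add: split_weight_def sum_distrib_left)
qed

lemma weighted_mean_split_weight:
  assumes "k \<le> m"
  shows "weighted_mean m (split_weight k a b) x =
     (a * (\<Sum>r\<in>{1..k}. real r * x r) + b * (\<Sum>r\<in>{k<..m}. real r * x r)) /
     (a * (\<Sum>r\<in>{1..k}. x r) + b * (\<Sum>r\<in>{k<..m}. x r))"
  using sum_split_weight[OF assms, of a b "\<lambda>r. real r * x r"] sum_split_weight[OF assms, of a b x]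
  by (simp add: weighted_mean_def mult.left_commute)

lemma weighted_sum_pos:
  assumes "x \<in> prob_simplex m" and "\<forall>r\<in>{1..m}. 0 < w r"
  shows "0 < (\<Sum>r=1..m. w r * x r)"
proof -
  have x0: "0 \<le> x r" if "r \<in> {1..m}" for r
    using assms(1) that by (auto simp: prob_simplex_def)
  have "sum x {1..m} \<noteq> 0"
    using assms(1) by (simp add: prob_simplex_def)
  then obtain s where s: "s \<in> {1..m}" "x s \<noteq> 0"
    by (rule sum.not_neutral_contains_not_neutral)
  show ?thesis
  proof (rule sum_pos2)
    show "0 < w s * x s"
      using s x0[OF s(1)] bspec[OF assms(2) s(1)] by simp
  qed (use s x0 assms(2) in \<open>auto intro!: mult_nonneg_nonneg intro: less_imp_le\<close>)
qed

text \<open>Turns comparisons with a mean, a quotient, into the sign of a sum linear in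
  \<open>w\<close>, since the total weight is positive.\<close>

lemma weighted_centered_sum:
  assumes "x \<in> prob_simplex m" and "\<forall>r\<in>{1..m}. 0 < w r"
  shows "(\<Sum>r=1..m. w r * x r * (real r - c)) =
    (weighted_mean m w x - c) * (\<Sum>r=1..m. w r * x r)"
proof -
  have "(\<Sum>r=1..m. w r * x r * (real r - c)) =
      (\<Sum>r=1..m. real r * (w r * x r)) - c * (\<Sum>r=1..m. w r * x r)"
    by (simp add: sum_subtractf sum_distrib_left algebra_simps)
  then show ?thesis
    using weighted_sum_pos[OF assms] by (simp add: weighted_mean_def left_diff_distrib)
qed

lemma le_weighted_mean_iff:
  assumes "x \<in> prob_simplex m" and "\<forall>r\<in>{1..m}. 0 < w r"
  shows "c \<le> weighted_mean m w x \<longleftrightarrow> 0 \<le> (\<Sum>r=1..m. w r * x r * (real r - c))"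
  using weighted_centered_sum[OF assms, of c] weighted_sum_pos[OF assms]
  by (simp add: zero_le_mult_iff)

lemma weighted_mean_le_iff:
  assumes "x \<in> prob_simplex m" and "\<forall>r\<in>{1..m}. 0 < w r"
  shows "weighted_mean m w x \<le> c \<longleftrightarrow> (\<Sum>r=1..m. w r * x r * (real r - c)) \<le> 0"
  using weighted_centered_sum[OF assms, of c] weighted_sum_pos[OF assms]
  by (simp add: mult_le_0_iff)

text \<open>Exchange argument: passing from \<open>w\<close> to \<open>v\<close> cannot decrease the
  sum centered at \<open>c\<close>. When \<open>c\<close> is one of the two means, its own centered
  sum vanishes and the sign of the other decides. The lower bound below uses the mean of
  \<open>w\<close>, the upper bound that of \<open>v\<close>.\<close>

lemma weighted_mean_le_weighted_mean:
  assumes x: "x \<in> prob_simplex m"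
    and w: "\<forall>r\<in>{1..m}. 0 < w r" and v: "\<forall>r\<in>{1..m}. 0 < v r"
    and le: "\<And>r. r \<in> {1..m} \<Longrightarrow> 0 \<le> (v r - w r) * (real r - c)"
    and c: "c = weighted_mean m w x \<or> c = weighted_mean m v x"
  shows "weighted_mean m w x \<le> weighted_mean m v x"
proof -
  have "(\<Sum>r=1..m. w r * x r * (real r - c)) \<le> (\<Sum>r=1..m. v r * x r * (real r - c))"
  proof (rule sum_mono)
    fix r assume r: "r \<in> {1..m}"
    then have "0 \<le> x r"
      using x by (auto simp: prob_simplex_def)
    from mult_nonneg_nonneg[OF this le[OF r]]
    show "w r * x r * (real r - c) \<le> v r * x r * (real r - c)"
      by (simp add: algebra_simps)
  qed
  then show ?thesis
    using c weighted_centered_sum[OF x w, of c] weighted_centered_sum[OF x v, of c]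
      le_weighted_mean_iff[OF x v, of c] weighted_mean_le_iff[OF x w, of c]
    by auto
qed

section \<open>Location of the extremal means\<close>

text \<open>\<open>G k\<close> is a centered sum at \<open>k\<close>, where rating \<open>k\<close>
  contributes 0 whatever its weight. Hence \<open>0 \<le> G k\<close> gives
  \<open>k \<le> M\<close>, and failure at \<open>k + 1\<close> gives
  \<open>M \<le> k + 1\<close>.\<close>

lemma split_threshold:
  fixes m :: nat and a b :: real and x :: "nat \<Rightarrow> real"
  defines "G \<equiv> \<lambda>k. a * (\<Sum>r\<in>{1..<k}. (real r - real k) * x r)
    + b * (\<Sum>r\<in>{k<..m}. (real r - real k) * x r)"
  defines "k \<equiv> Max {k \<in> {1..m}. 0 \<le> G k}"
  defines "M \<equiv> weighted_mean m (split_weight k a b) x"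
  assumes m: "1 \<le> m" and x: "x \<in> prob_simplex m" and a: "0 < a" and b: "0 < b"
  shows "k \<in> {1..m}"
    and "\<And>r. r \<le> k \<Longrightarrow> real r \<le> M"
    and "\<And>r. \<lbrakk>k < r; r \<le> m\<rbrakk> \<Longrightarrow> M \<le> real r"
proof -
  have x0: "0 \<le> x r" if "r \<in> {1..m}" for r
    using x that by (auto simp: prob_simplex_def)
  have "0 \<le> G 1"
    using x0 b by (auto simp: G_def intro!: mult_nonneg_nonneg sum_nonneg)
  then have ne: "1 \<in> {k \<in> {1..m}. 0 \<le> G k}"
    using m by simp
  have "k \<in> {k \<in> {1..m}. 0 \<le> G k}"
    unfolding k_def using ne by (intro Max_in) auto
  then have k: "k \<in> {1..m}" and Gk: "0 \<le> G k"
    by auto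
  from k show "k \<in> {1..m}" .
  have pos: "\<forall>r\<in>{1..m}. 0 < split_weight k a b r"
    using a b by (simp add: split_weight_def)
  have sum: "(\<Sum>r=1..m. split_weight k a b r * x r * (real r - c)) =
      a * (\<Sum>r\<in>{1..k}. (real r - c) * x r) + b * (\<Sum>r\<in>{k<..m}. (real r - c) * x r)" for c
    using sum_split_weight[of k m a b "\<lambda>r. (real r - c) * x r"] k by (simp add: mult_ac)
  have "{1..k} = insert k {1..<k}"
    using k by auto
  then have "real k \<le> M"
    unfolding M_def le_weighted_mean_iff[OF x pos] sum using Gk by (simp add: G_def)
  then show "real r \<le> M" if "r \<le> k" for r
    using that by linarith
  show "M \<le> real r" if "k < r" "r \<le> m" for r
  proof -
    have "\<not> 0 \<le> G (Suc k)"
    proof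
      assume "0 \<le> G (Suc k)"
      then have "Suc k \<in> {k \<in> {1..m}. 0 \<le> G k}"
        using that by simp
      then have "Suc k \<le> k"
        by (subst (2) k_def, intro Max_ge) auto
      then show False by simp
    qed
    \<comment> \<open>Centered at \<open>Suc k\<close>, rating \<open>Suc k\<close> contributes 0,
      so \<open>G (Suc k)\<close> is also the centered sum for cutoff \<open>k\<close>.\<close>
    moreover have "{k<..m} = insert (Suc k) {Suc k<..m}"
      using that by auto
    ultimately have "M \<le> real (Suc k)"
      unfolding M_def weighted_mean_le_iff[OF x pos] sum
      by (simp add: G_def atLeastLessThanSuc_atLeastAtMost del: sum.op_ivl_Suc)
    then show ?thesis
      using that by linarith
  qed
qed

lemma lower_est_attained:
  assumes "1 \<le> m" and "x \<in> prob_simplex m" and "0 < q"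
  shows "lower_est m q x = weighted_mean m (split_weight (k1 m q x) 1 q) x"
  using split_threshold(1)[OF assms(1,2) zero_less_one assms(3)]
  by (simp add: lower_est_def Let_def weighted_mean_split_weight k1_def)

lemma upper_est_attained:
  assumes "1 \<le> m" and "x \<in> prob_simplex m" and "0 < q"
  shows "upper_est m q x = weighted_mean m (split_weight (k2 m q x) q 1) x"
  using split_threshold(1)[OF assms zero_less_one]
  by (simp add: upper_est_def Let_def weighted_mean_split_weight k2_def)

text \<open>Any admissible \<open>v\<close> is at most 1 up to the cutoff and at least
  \<open>q\<close> above it, and the cutoff separates the ratings on either side of the extremal
  mean, so the exchange argument applies.\<close>

lemma lower_est_le:
  assumes x: "1 \<le> m" "x \<in> prob_simplex m" "0 < q" and v: "\<forall>r\<in>{1..m}. v r \<in> {q..1}"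
  shows "lower_est m q x \<le> weighted_mean m v x"
proof -
  let ?w = "split_weight (k1 m q x) 1 q"
  note thr = split_threshold(2,3)[OF x(1,2) zero_less_one x(3), simplified, folded k1_def[simplified]]
  have "weighted_mean m ?w x \<le> weighted_mean m v x"
  proof (rule weighted_mean_le_weighted_mean[OF x(2), where c = "weighted_mean m ?w x"])
    fix r assume r: "r \<in> {1..m}"
    show "0 \<le> (v r - ?w r) * (real r - weighted_mean m ?w x)"
      using bspec[OF v r] thr r
      by (cases "r \<le> k1 m q x") (auto simp: split_weight_def[of _ _ _ r] zero_le_mult_iff)
  qed (use x(3) v in \<open>auto simp: split_weight_def intro: less_le_trans\<close>)
  then show ?thesis
    by (simp add: lower_est_attained[OF x])
qed

lemma le_upper_est:
  assumes x: "1 \<le> m" "x \<in> prob_simplex m" "0 < q" and v: "\<forall>r\<in>{1..m}. v r \<in> {q..1}"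
  shows "weighted_mean m v x \<le> upper_est m q x"
proof -
  let ?w = "split_weight (k2 m q x) q 1"
  note thr = split_threshold(2,3)[OF x zero_less_one, simplified, folded k2_def[simplified]]
  have "weighted_mean m v x \<le> weighted_mean m ?w x"
  proof (rule weighted_mean_le_weighted_mean[OF x(2), where c = "weighted_mean m ?w x"])
    fix r assume r: "r \<in> {1..m}"
    show "0 \<le> (?w r - v r) * (real r - weighted_mean m ?w x)"
      using bspec[OF v r] thr r
      by (cases "r \<le> k2 m q x") (auto simp: split_weight_def[of _ _ _ r] zero_le_mult_iff)
  qed (use x(3) v in \<open>auto simp: split_weight_def intro: less_le_trans\<close>)
  then show ?thesis
    by (simp add: upper_est_attained[OF x])
qed

section \<open>Possible true means are exactly the reweighted means\<close>

text \<open>Dividing by \<open>g\<close> undoes the selection; the factor \<open>q\<close> cancels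
  in the quotient and only brings the weights into \<open>[q, 1]\<close>.\<close>

lemma mean_rating_as_weighted_mean:
  assumes "0 < q" and p: "p \<in> prob_simplex m" and g: "g \<in> report_probs m q"
  shows "mean_rating m p = weighted_mean m (\<lambda>r. q / g r) (observed m p g)"
proof -
  define S where "S = (\<Sum>j=1..m. p j * g j)"
  have g0: "\<forall>r\<in>{1..m}. 0 < g r"
    using g \<open>0 < q\<close> by (force simp: report_probs_def PiE_def Pi_def)
  have S: "0 < S"
    using weighted_sum_pos[OF p g0] by (simp add: S_def mult.commute)
  have w: "q / g r * observed m p g r = q / S * p r" if "r \<in> {1..m}" for r
    using bspec[OF g0 that] unfolding observed_def S_def[symmetric] by simp
  have "(\<Sum>r=1..m. q / g r * observed m p g r) = (\<Sum>r=1..m. q / S * p r)"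
    using w by (rule sum.cong[OF refl])
  then have "(\<Sum>r=1..m. q / g r * observed m p g r) = q / S"
    unfolding sum_distrib_left[symmetric] using p by (simp add: prob_simplex_def)
  moreover have "(\<Sum>r=1..m. real r * (q / g r * observed m p g r)) = q / S * mean_rating m p"
    by (simp only: w cong: sum.cong) (simp add: mean_rating_def sum_distrib_left mult_ac)
  ultimately show ?thesis
    using S \<open>0 < q\<close> by (simp add: weighted_mean_def)
qed

lemma weighted_mean_realized:
  assumes "0 < q" and x: "x \<in> prob_simplex m" and w: "\<forall>r\<in>{1..m}. w r \<in> {q..1}"
  obtains p g where "p \<in> prob_simplex m" "g \<in> report_probs m q"
    "observed m p g = x" "mean_rating m p = weighted_mean m w x"
proof
  define S where "S = (\<Sum>r=1..m. w r * x r)"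
  define p where "p = (\<lambda>r. w r * x r / S)"
  \<comment> \<open>Inverse of the weights \<open>q / g r\<close>, so that \<open>p r * g r\<close>
    is proportional to \<open>x r\<close>; restricted because members of \<open>report_probs\<close>
    are extensional.\<close>
  define g where "g = restrict (\<lambda>r. q / w r) {1..m}"
  have w0: "\<forall>r\<in>{1..m}. 0 < w r"
    using w \<open>0 < q\<close> by fastforce
  have S: "0 < S"
    unfolding S_def using weighted_sum_pos[OF x w0] .
  have pg: "p r * g r = q / S * x r" if "r \<in> {1..m}" for r
    using bspec[OF w0 that] that by (simp add: p_def g_def)
  have "(\<Sum>j=1..m. p j * g j) = (\<Sum>j=1..m. q / S * x j)"
    using pg by (rule sum.cong[OF refl])
  then have "(\<Sum>j=1..m. p j * g j) = q / S"
    unfolding sum_distrib_left[symmetric] using x by (simp add: prob_simplex_def)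
  then have "observed m p g r = x r" for r
    using pg[of r] S \<open>0 < q\<close> x
    by (cases "r \<in> {1..m}") (auto simp: observed_def p_def prob_simplex_def)
  then show "observed m p g = x" ..
  show "p \<in> prob_simplex m"
    using x S w0
    by (auto simp: prob_simplex_def p_def S_def simp flip: sum_divide_distrib)
  show "g \<in> report_probs m q"
    using w w0 \<open>0 < q\<close>
    by (force simp: report_probs_def g_def pos_le_divide_eq mult_left_le)
  show "mean_rating m p = weighted_mean m w x"
    by (simp add: mean_rating_def p_def weighted_mean_def S_def sum_divide_distrib)
qed

theorem theorem4p2:
  fixes m :: nat and q :: real and f :: "(nat \<Rightarrow> real) \<Rightarrow> real"
  assumes "2 \<le> m" and "0 < q" and "q \<le> 1"
  shows "worst_case_regret m q (PAA m q) \<le> worst_case_regret m q f"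
  unfolding worst_case_regret_def[of m q "PAA m q"]
proof (rule SUP_least, clarify)
  fix p g assume p: "p \<in> prob_simplex m" and g: "g \<in> report_probs m q"
  \<comment> \<open>The comparison is made separately for each observation \<open>x\<close>.\<close>
  define x where "x = observed m p g"
  define l where "l = lower_est m q x"
  define u where "u = upper_est m q x"
  have x: "x \<in> prob_simplex m"
    unfolding x_def using observed_in_prob_simplex[OF \<open>0 < q\<close> p g] .
  have m: "1 \<le> m"
    using assms by simp
  have v: "\<forall>r\<in>{1..m}. q / g r \<in> {q..1}"
  proof
    fix r assume "r \<in> {1..m}"
    then have "q \<le> g r" "g r \<le> 1"
      using g by (auto simp: report_probs_def PiE_def Pi_def)
    then show "q / g r \<in> {q..1}"
      using \<open>0 < q\<close> by (simp add: pos_le_divide_eq mult_left_le)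
  qed
  have l: "l \<le> mean_rating m p" and u: "mean_rating m p \<le> u"
    using lower_est_le[OF m x \<open>0 < q\<close> v] le_upper_est[OF m x \<open>0 < q\<close> v]
    by (simp_all add: mean_rating_as_weighted_mean[OF \<open>0 < q\<close> p g] l_def u_def x_def)
  have regret: "regret m (PAA m q) p g \<le> ((u - l) / 2)\<^sup>2"
    unfolding regret_def abs_le_square_iff[symmetric]
    using l u by (simp add: PAA_def field_simps flip: x_def l_def u_def)
  \<comment> \<open>All reweighted means of \<open>x\<close> are true means of pairs that
    \<open>f\<close> cannot tell apart; this is applied to \<open>l\<close> and
    \<open>u\<close>.\<close>
  have attained: "ereal ((f x - weighted_mean m w x)\<^sup>2) \<le> worst_case_regret m q f"
    if w: "\<forall>r\<in>{1..m}. w r \<in> {q..1}" for w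
  proof -
    obtain p' g' where "p' \<in> prob_simplex m" "g' \<in> report_probs m q"
      "observed m p' g' = x" "mean_rating m p' = weighted_mean m w x"
      using weighted_mean_realized[OF \<open>0 < q\<close> x w] by blast
    then show ?thesis
      unfolding worst_case_regret_def by (intro SUP_upper2[of "(p', g')"]) (auto simp: regret_def)
  qed
  have fl: "ereal ((f x - l)\<^sup>2) \<le> worst_case_regret m q f"
    unfolding l_def lower_est_attained[OF m x \<open>0 < q\<close>]
    using assms by (intro attained) (simp add: split_weight_def)
  have fu: "ereal ((f x - u)\<^sup>2) \<le> worst_case_regret m q f"
    unfolding u_def upper_est_attained[OF m x \<open>0 < q\<close>]
    using assms by (intro attained) (simp add: split_weight_def)
  \<comment> \<open>If \<open>f x\<close> is at most the midpoint it is far from \<open>u\<close>,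
    otherwise far from \<open>l\<close>.\<close>
  have "\<bar>(u - l) / 2\<bar> \<le> \<bar>f x - l\<bar> \<or> \<bar>(u - l) / 2\<bar> \<le> \<bar>f x - u\<bar>"
    using l u abs_ge_self[of "f x - l"] abs_ge_minus_self[of "f x - u"]
    by (cases "f x \<le> (u + l) / 2") simp_all
  then have "((u - l) / 2)\<^sup>2 \<le> (f x - l)\<^sup>2 \<or> ((u - l) / 2)\<^sup>2 \<le> (f x - u)\<^sup>2"
    by (simp only: abs_le_square_iff)
  then have "ereal (((u - l) / 2)\<^sup>2) \<le> worst_case_regret m q f"
    using fl fu by (auto intro: order_trans[rotated])
  then show "ereal (regret m (PAA m q) p g) \<le> worst_case_regret m q f"
    using regret by (auto intro: order_trans[rotated])
qed

end
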